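(* \[ \sum_{k=1}^{\infty}(8k+1)\frac{(\tfrac{1}{2})_k(\tfrac{1}{4})_k(\tfrac{3}{4})_k}{k!^3\,9^k}\sum_{i=1}^{k}\left\{\frac{1}{(2i-1)^2}-\frac{1}{36i^2}\right\}=\frac{\sqrt{3}\,\pi}{54}. \]
   Context: For a complex number $x$ and a nonnegative integer $n$, $(x)_n=\Gamma(x+n)/\Gamma(x)=x(x+1)\cdots(x+n-1)$ denotes the shifted factorial (Pochhammer symbol), with $(x)_0=1$. *)

theory Defs
  imports "HOL-Analysis.Analysis"
begin

end

theory Submission
  imports Defs "HOL-Complex_Analysis.Complex_Analysis" "HOL-Real_Asymp.Real_Asymp"
begin

text \<open>
  Inserting a parameter into Ramanujan's series for \<open>2\<surd>3/\<pi>\<close> gives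
  \[ \sum_{k\ge 0} (8k+1) \frac{(\frac12)_{2k}}{(2k)!}\,
     \frac{(\frac12+3y)_k (\frac12-3y)_k}{(1+y)_k (1-y)_k\, 9^k} = 2\sqrt 3\, y \cot(\pi y), \]
  and the theorem is the coefficient of \<open>y\<^sup>2\<close>. Divided by \<open>y\<close>, the left-hand side is 1-periodic by a
  WZ-type telescoping, has simple poles with equal residues at the integers, and grows at most
  polynomially in vertical strips. Subtracting the multiple of \<open>cot (\<pi> y)\<close> with the same poles leaves
  an entire periodic function of polynomial growth, which is constant by Liouville's theorem, and
  zero because it is odd. The constant \<open>2\<surd>3\<close> is read off at \<open>y = 1/6\<close>, where the series terminates.
\<close>

section \<open>The deformed series and its domain\<close>

definition ram_coeff :: "nat \<Rightarrow> complex"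
  where "ram_coeff k = pochhammer (1/2) (2 * k) / fact (2 * k)"

text \<open>The variable \<open>u\<close> stands for \<open>y\<^sup>2\<close>.\<close>

definition ram_prod :: "nat \<Rightarrow> complex \<Rightarrow> complex"
  where "ram_prod k u =
    (\<Prod>i<k. ((of_nat i + 1/2)\<^sup>2 / 9 - u) / ((of_nat i + 1)\<^sup>2 - u))"

definition ram_term :: "nat \<Rightarrow> complex \<Rightarrow> complex"
  where "ram_term k u = (8 * of_nat k + 1) * ram_coeff k * ram_prod k u"

definition ram_series :: "complex \<Rightarrow> complex"
  where "ram_series u = (\<Sum>k. ram_term k u)"

text \<open>The plane cut along the real ray from 1 to infinity. The poles
  \<open>u = (i + 1)^2\<close> of all terms lie on the cut, so every term is holomorphic on this one
  open set, which contains 0 and the square of every \<open>y\<close> with real part strictly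
  between -1 and 1.\<close>

definition slit_plane :: "complex set"
  where "slit_plane = - (\<real> \<inter> {w. 1 \<le> Re w})"

lemma open_slit_plane: "open slit_plane"
  unfolding slit_plane_def by (intro open_Compl closed_Real_halfspace_Re_ge)

lemma zero_in_slit_plane [simp]: "0 \<in> slit_plane"
  by (simp add: slit_plane_def)

lemma slit_plane_denominator:
  assumes "u \<in> slit_plane"
  shows "(of_nat i + 1)\<^sup>2 - u \<noteq> 0"
proof
  assume "(of_nat i + 1)\<^sup>2 - u = 0"
  then have "u = of_real ((real i + 1)\<^sup>2)" by simp
  moreover have "1 \<le> (real i + 1)\<^sup>2" by (simp add: power2_eq_square algebra_simps)
  ultimately have "u \<in> \<real> \<inter> {w. 1 \<le> Re w}" by (metis Int_iff Re_complex_of_real Reals_of_real mem_Collect_eq)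
  with assms show False by (simp add: slit_plane_def)
qed

lemma square_in_slit_plane:
  assumes "\<bar>Re y\<bar> < 1"
  shows "y\<^sup>2 \<in> slit_plane"
proof (rule ccontr)
  assume "y\<^sup>2 \<notin> slit_plane"
  then have "Im (y\<^sup>2) = 0" "1 \<le> Re (y\<^sup>2)"
    by (auto simp: slit_plane_def complex_is_Real_iff)
  then have *: "Re y * Im y = 0" "1 \<le> (Re y)\<^sup>2 - (Im y)\<^sup>2"
    by (auto simp: power2_eq_square)
  have "(Re y)\<^sup>2 < 1" using assms by (simp add: abs_square_less_1)
  with * show False by (smt (verit) zero_le_power2)
qed

section \<open>Recurrences and geometric bounds for the terms\<close>

lemma ram_prod_Suc:
  "ram_prod (Suc k) u =
     ram_prod k u * (((of_nat k + 1/2)\<^sup>2 / 9 - u) / ((of_nat k + 1)\<^sup>2 - u))"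
  by (simp add: ram_prod_def)

lemma ram_coeff_Suc:
  "ram_coeff (Suc k) = ram_coeff k *
     ((2 * of_nat k + 1/2) * (2 * of_nat k + 3/2) / ((2 * of_nat k + 1) * (2 * of_nat k + 2)))"
proof -
  have "fact (2 * Suc k) = (fact (2 * k) :: complex) * ((2 * of_nat k + 1) * (2 * of_nat k + 2))"
    by (simp add: algebra_simps)
  moreover have "pochhammer (1/2 :: complex) (2 * Suc k) =
      pochhammer (1/2) (2 * k) * ((2 * of_nat k + 1/2) * (2 * of_nat k + 3/2))"
    by (simp add: pochhammer_Suc algebra_simps)
  ultimately show ?thesis unfolding ram_coeff_def by simp
qed

lemma norm_ram_coeff_le_1: "norm (ram_coeff k) \<le> 1"
proof -
  have "norm (pochhammer (1/2::complex) n) \<le> fact n" for n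
  proof (induction n)
    case (Suc n)
    have "norm (1/2 + of_nat n :: complex) \<le> 1 + real n"
      by (rule order_trans[OF norm_triangle_ineq]) simp
    then show ?case
      using mult_mono[OF Suc, of "norm (1/2 + of_nat n :: complex)" "1 + real n"]
      unfolding pochhammer_Suc norm_mult by (simp add: mult.commute)
  qed simp
  then show ?thesis
    by (simp add: ram_coeff_def norm_divide divide_le_eq_1)
qed

text \<open>With \<open>B = (i + 1)^2\<close> and \<open>norm u\<close> at most \<open>B/4\<close>,
  the numerator is at most \<open>B/9 + B/4 = 13B/36\<close> and the denominator at least
  \<open>3B/4 = 27B/36\<close>, so the quotient is at most 13/27. This gives geometric decay with
  ratio 1/2 once the index is large compared with the square root of \<open>norm u\<close>.\<close>

lemma norm_ratio_le_half:
  fixes u :: complex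
  assumes "4 * norm u \<le> (real i + 1)\<^sup>2"
  shows "norm (((of_nat i + 1/2)\<^sup>2 / 9 - u) / ((of_nat i + 1)\<^sup>2 - u)) \<le> 1/2"
proof -
  define B where "B = (real i + 1)\<^sup>2"
  have B: "B > 0" unfolding B_def by simp
  have A: "norm ((of_nat i + 1/2)\<^sup>2 / 9 :: complex) \<le> B / 9"
  proof -
    have "(of_nat i + 1/2)\<^sup>2 / 9 = complex_of_real ((real i + 1/2)\<^sup>2 / 9)" by simp
    then have "norm ((of_nat i + 1/2)\<^sup>2 / 9 :: complex) = (real i + 1/2)\<^sup>2 / 9"
      by (metis norm_of_real abs_of_nonneg zero_le_divide_iff zero_le_power2 zero_le_numeral)
    also have "\<dots> \<le> B / 9" unfolding B_def by (intro divide_right_mono power_mono) auto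
    finally show ?thesis .
  qed
  have num: "norm ((of_nat i + 1/2)\<^sup>2 / 9 - u) \<le> B / 9 + B / 4"
    using A assms norm_triangle_ineq4[of "(of_nat i + 1/2)\<^sup>2 / 9" u] unfolding B_def by linarith
  have "norm ((of_nat i + 1)\<^sup>2 :: complex) = B"
  proof -
    have "(of_nat i + 1)\<^sup>2 = complex_of_real B" by (simp add: B_def)
    then show ?thesis using B by (metis norm_of_real abs_of_pos)
  qed
  then have den: "norm ((of_nat i + 1)\<^sup>2 - u) \<ge> 3 * B / 4"
    using assms norm_triangle_ineq2[of "(of_nat i + 1)\<^sup>2" u] unfolding B_def by linarith
  have "norm ((of_nat i + 1/2)\<^sup>2 / 9 - u) \<le> 1/2 * norm ((of_nat i + 1)\<^sup>2 - u)"
    using num den B by linarith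
  moreover have "norm ((of_nat i + 1)\<^sup>2 - u) > 0" using den B by linarith
  ultimately show ?thesis by (simp add: norm_divide divide_le_eq)
qed

lemma ram_prod_tail_bound:
  assumes "\<And>i. i \<ge> N \<Longrightarrow> 4 * norm u \<le> (real i + 1)\<^sup>2"
  shows "norm (ram_prod (N + j) u) \<le> norm (ram_prod N u) * (1/2)^j"
proof (induction j)
  case (Suc j)
  have "norm (ram_prod (N + Suc j) u) = norm (ram_prod (N + j) u) *
     norm (((of_nat (N + j) + 1/2)\<^sup>2 / 9 - u) / ((of_nat (N + j) + 1)\<^sup>2 - u))"
    by (simp only: add_Suc_right ram_prod_Suc norm_mult)
  also have "\<dots> \<le> (norm (ram_prod N u) * (1/2)^j) * (1/2)"
    by (intro mult_mono Suc norm_ratio_le_half assms) auto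
  finally show ?case by simp
qed simp

lemma norm_linear_nat: "norm (8 * of_nat k + 1 :: complex) = 8 * real k + 1"
proof -
  have "8 * of_nat k + 1 = complex_of_real (8 * real k + 1)" by simp
  then show ?thesis by (metis norm_of_real abs_of_nonneg add_nonneg_nonneg mult_nonneg_nonneg of_nat_0_le_iff zero_le_numeral zero_le_one)
qed

lemma norm_ram_term_le: "norm (ram_term k u) \<le> (8 * real k + 1) * norm (ram_prod k u)"
proof -
  have "norm (ram_term k u) = (8 * real k + 1) * norm (ram_coeff k) * norm (ram_prod k u)"
    by (simp add: ram_term_def norm_mult norm_linear_nat)
  also have "\<dots> \<le> (8 * real k + 1) * 1 * norm (ram_prod k u)"
    by (intro mult_mono norm_ram_coeff_le_1) auto
  finally show ?thesis by simp
qed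

lemma summable_linear_geometric: "summable (\<lambda>j. (A + B * real j) * (1/2)^j)"
proof -
  have "summable (\<lambda>j. real (Suc j) * (1/2::real)^j)"
    using geometric_deriv_sums[of "1/2::real"] sums_summable by fastforce
  then have "summable (\<lambda>j. (A - B) * (1/2)^j + B * (real (Suc j) * (1/2)^j))"
    by (intro summable_add summable_mult summable_geometric) auto
  moreover have "(A - B) * (1/2)^j + B * (real (Suc j) * (1/2)^j) = (A + B * real j) * (1/2)^j" for j
    by (simp add: algebra_simps)
  ultimately show ?thesis by (simp only:)
qed

section \<open>Derivative at zero, holomorphy and termwise differentiation\<close>

text \<open>Logarithmic differentiation: a factor \<open>(A - u) / (B - u)\<close> has logarithmic
  derivative \<open>1/B - 1/A\<close> at 0, here with \<open>A = (2i + 1)^2 / 36\<close> and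
  \<open>B = (i + 1)^2\<close>. This is the source of the inner sum in the theorem.\<close>

lemma ram_prod_has_derivative_0:
  "(ram_prod k has_field_derivative
     (ram_prod k 0 * (\<Sum>i<k. 1 / (of_nat i + 1)\<^sup>2 - 36 / (2 * of_nat i + 1)\<^sup>2))) (at 0)"
proof -
  define r where "r = (\<lambda>i u :: complex. ((of_nat i + 1/2)\<^sup>2 / 9 - u) / ((of_nat i + 1)\<^sup>2 - u))"
  have nz: "of_nat i + 1 \<noteq> (0::complex)" "2 * of_nat i + 1 \<noteq> (0::complex)" for i :: nat
    by (metis of_nat_Suc of_nat_eq_0_iff add.commute nat.distinct(1))
       (metis of_nat_Suc of_nat_eq_0_iff of_nat_mult of_nat_numeral add.commute nat.distinct(1))
  have h: "of_nat i + 1/2 = (2 * of_nat i + 1 :: complex) / 2" for i by simp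
  \<comment> \<open>The quotient by \<open>r i 0\<close> is the shape that the product rule
    delivers; it cancels below because no factor vanishes at 0.\<close>
  have "((\<lambda>u. \<Prod>i<k. r i u) has_field_derivative
     (\<Prod>i<k. r i 0) * (\<Sum>i<k. (r i 0 * (1 / (of_nat i + 1)\<^sup>2 - 36 / (2 * of_nat i + 1)\<^sup>2)) / r i 0)) (at 0)"
  proof (rule has_field_derivative_prod')
    fix i
    show "r i 0 \<noteq> 0" using nz[of i] unfolding r_def h by simp
    show "(r i has_field_derivative r i 0 * (1 / (of_nat i + 1)\<^sup>2 - 36 / (2 * of_nat i + 1)\<^sup>2)) (at 0)"
    proof -
      define A B where "A = (2 * of_nat i + 1 :: complex)\<^sup>2 / 36" and "B = (of_nat i + 1 :: complex)\<^sup>2"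
      have AB: "A \<noteq> 0" "B \<noteq> 0" using nz[of i] by (auto simp: A_def B_def)
      have "((\<lambda>u. (A - u) / (B - u)) has_field_derivative
           ((0 - 1) * (B - 0) - (A - 0) * (0 - 1)) / ((B - 0) * (B - 0))) (at 0)"
        by (intro DERIV_divide DERIV_diff DERIV_const DERIV_ident) (use AB in simp)
      moreover have "((0 - 1) * (B - 0) - (A - 0) * (0 - 1)) / ((B - 0) * (B - 0)) =
          (A - 0) / (B - 0) * (1 / B - 1 / A)"
        using AB by (simp add: field_simps)
      moreover have "1 / A = 36 / (2 * of_nat i + 1)\<^sup>2" by (simp add: A_def)
      moreover have "r i = (\<lambda>u. (A - u) / (B - u))"
        unfolding r_def h A_def B_def by (simp add: power_divide)
      ultimately show ?thesis unfolding B_def by metis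
    qed
  qed
  moreover have "r i 0 \<noteq> 0" for i using nz[of i] unfolding r_def h by simp
  then have "r i 0 * c / r i 0 = c" for i c by simp
  moreover have "ram_prod k = (\<lambda>u. \<Prod>i<k. r i u)"
    by (rule ext) (simp only: ram_prod_def r_def)
  ultimately show ?thesis by (simp only:)
qed

lemma ram_prod_holomorphic: "ram_prod k holomorphic_on slit_plane"
  unfolding ram_prod_def[abs_def]
  by (intro holomorphic_intros slit_plane_denominator)

lemma ram_term_holomorphic: "ram_term k holomorphic_on slit_plane"
  unfolding ram_term_def[abs_def]
  by (intro holomorphic_intros ram_prod_holomorphic)

text \<open>On a closed disc inside the domain one index \<open>N\<close> starts the geometric decay
  for all points at once. The product up to \<open>N\<close> is bounded by compactness, and each
  later factor at least halves it, which leaves a majorant of the form linear times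
  geometric.\<close>

lemma ram_term_locally_dominated:
  assumes "x \<in> slit_plane"
  shows "\<exists>d h. 0 < d \<and> summable h \<and>
    (\<forall>\<^sub>F n in sequentially. \<forall>y\<in>ball x d \<inter> slit_plane. norm (ram_term n y) \<le> h n)"
proof -
  obtain d where d: "d > 0" "cball x d \<subseteq> slit_plane"
    using open_slit_plane assms open_contains_cball by blast
  define M where "M = norm x + d"
  obtain N :: nat where N: "real N \<ge> 4 * M" using real_arch_simple by blast
  have big: "4 * norm u \<le> (real i + 1)\<^sup>2" if "u \<in> cball x d" "i \<ge> N" for u i
  proof -
    have "norm u \<le> M" using that norm_triangle_ineq2[of u x] unfolding M_def
      by (simp add: dist_norm norm_minus_commute)
    then have "4 * norm u \<le> real i" using N that by linarith
    also have "\<dots> \<le> (real i + 1)\<^sup>2" by (simp add: power2_eq_square algebra_simps)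
    finally show ?thesis .
  qed
  have "bounded (ram_prod N ` cball x d)"
    by (intro compact_imp_bounded compact_continuous_image compact_cball
         continuous_on_subset[OF holomorphic_on_imp_continuous_on[OF ram_prod_holomorphic] d(2)])
  then obtain C where C: "\<And>u. u \<in> cball x d \<Longrightarrow> norm (ram_prod N u) \<le> C"
    unfolding bounded_iff by blast
  have bd: "norm (ram_term n u) \<le> (8 * real n + 1) * (C * 2^N * (1/2)^n)"
    if nN: "n \<ge> N" and "u \<in> cball x d" for n u
  proof -
    obtain j where j: "n = N + j" using le_Suc_ex[OF nN] by auto
    have "norm (ram_prod n u) \<le> norm (ram_prod N u) * (1/2)^j"
      unfolding j by (rule ram_prod_tail_bound) (use big that in auto)
    also have "\<dots> \<le> C * (1/2)^j" using C that by (intro mult_right_mono) auto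
    also have "\<dots> = C * 2^N * (1/2)^n" unfolding j by (simp add: power_add power_one_over)
    finally show ?thesis
      by (intro order_trans[OF norm_ram_term_le] mult_left_mono) auto
  qed
  have "summable (\<lambda>n. (8 * real n + 1) * (C * 2^N * (1/2)^n))"
    using summable_mult[OF summable_linear_geometric[of 1 8], of "C * 2^N"]
    by (simp add: algebra_simps)
  moreover have "\<forall>\<^sub>F n in sequentially. \<forall>y\<in>ball x d \<inter> slit_plane.
       norm (ram_term n y) \<le> (8 * real n + 1) * (C * 2^N * (1/2)^n)"
    using bd by (intro eventually_sequentiallyI[of N]) auto
  ultimately show ?thesis using d(1) by blast
qed

text \<open>Local domination by a summable sequence makes the series locally uniformly convergent,
  so it may be differentiated term by term. The series of the theorem is, up to the factor -36, the
  differentiated series at 0.\<close>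

lemma ram_series_derivative:
  shows ram_term_sums: "u \<in> slit_plane \<Longrightarrow> (\<lambda>k. ram_term k u) sums ram_series u"
    and ram_series_holomorphic: "ram_series holomorphic_on slit_plane"
    and deriv_ram_term_sums:
      "u \<in> slit_plane \<Longrightarrow> (\<lambda>k. deriv (ram_term k) u) sums deriv ram_series u"
proof -
  have "\<exists>g g'. \<forall>x \<in> slit_plane. ((\<lambda>n. ram_term n x) sums g x) \<and>
     ((\<lambda>n. deriv (ram_term n) x) sums g' x) \<and> (g has_field_derivative g' x) (at x)"
    by (rule series_and_derivative_comparison_local[OF open_slit_plane])
       (fact holomorphic_derivI[OF ram_term_holomorphic open_slit_plane] ram_term_locally_dominated)+
  then obtain g g' where g: "\<And>x. x \<in> slit_plane \<Longrightarrow> (\<lambda>n. ram_term n x) sums g x"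
     "\<And>x. x \<in> slit_plane \<Longrightarrow> (\<lambda>n. deriv (ram_term n) x) sums g' x"
     "\<And>x. x \<in> slit_plane \<Longrightarrow> (g has_field_derivative g' x) (at x)" by blast
  have eq: "ram_series x = g x" if "x \<in> slit_plane" for x
    using g(1)[OF that] by (simp add: ram_series_def sums_iff)
  have der: "(ram_series has_field_derivative g' x) (at x)" if "x \<in> slit_plane" for x
    using g(3)[OF that] has_field_derivative_transform_within_open[OF _ open_slit_plane that, of g "g' x" ram_series] eq by simp
  show "u \<in> slit_plane \<Longrightarrow> (\<lambda>k. ram_term k u) sums ram_series u" using g(1) eq by simp
  show "ram_series holomorphic_on slit_plane"
    using der open_slit_plane by (auto simp: holomorphic_on_open)
  show "u \<in> slit_plane \<Longrightarrow> (\<lambda>k. deriv (ram_term k) u) sums deriv ram_series u"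
    using g(2) der DERIV_imp_deriv by metis
qed

section \<open>Periodicity by telescoping\<close>

text \<open>
  \<open>X k\<close> is the common hypergeometric part of the terms at \<open>y\<close> and at \<open>y + 1\<close>. For nonreal \<open>y\<close> no
  denominator vanishes.
\<close>

lemma ram_prod_shift:
  fixes y a :: complex and X :: "nat \<Rightarrow> complex"
  assumes im: "Im y \<noteq> 0" and a_def: "a = 3 * y + 3/2"
    and X_def: "\<And>k. X k = pochhammer a k * pochhammer (- a) k / (9 ^ k * pochhammer (1 + y) k * pochhammer (- y) k)"
  shows "ram_prod k (y\<^sup>2) = - y * X k * (of_nat k - a) * (of_nat k + 1 - a)
            / (a * (a + of_nat k - 1) * (of_nat k - y))"
    and "ram_prod k ((y + 1)\<^sup>2) = - (1 + y) * X k * (a + of_nat k) * (a + of_nat k + 1)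
            / (a * (of_nat k - 1 - a) * (of_nat k + 1 + y))"
    and "X (Suc k) = X k * ((a + of_nat k) * (of_nat k - a) / (9 * (1 + y + of_nat k) * (of_nat k - y)))"
proof -
  have a0: "a \<noteq> 0" "a \<noteq> 1" "a \<noteq> -1" using im by (auto simp: a_def complex_eq_iff)
  have y0: "y \<noteq> 0" "y \<noteq> -1" "1 + y \<noteq> 0" using im by (auto simp: complex_eq_iff)
  show X_Suc: "X (Suc k) = X k * ((a + of_nat k) * (of_nat k - a) / (9 * (1 + y + of_nat k) * (of_nat k - y)))" for k
    by (simp add: X_def pochhammer_Suc algebra_simps)
  have n: "of_nat n - a \<noteq> 0" "of_nat n + 1 - a \<noteq> 0" "of_nat n - 1 - a \<noteq> 0" "a + of_nat n \<noteq> 0"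
     "a + of_nat n - 1 \<noteq> 0" "a + of_nat n + 1 \<noteq> 0"
     "of_nat n - y \<noteq> 0" "of_nat n + 1 - y \<noteq> 0" "of_nat n + 1 + y \<noteq> 0" "1 + y + of_nat n \<noteq> 0"
     "of_nat n + 2 + y \<noteq> 0" for n :: nat
    using im by (auto simp: a_def complex_eq_iff)
  show "ram_prod k (y\<^sup>2) = - y * X k * (of_nat k - a) * (of_nat k + 1 - a)
            / (a * (a + of_nat k - 1) * (of_nat k - y))"
  proof (induction k)
    case 0
    then show ?case using a0 y0 by (simp add: X_def ram_prod_def field_simps)
  next
    case (Suc k)
    define K where "K = (of_nat k :: complex)"
    \<comment> \<open>Since \<open>3 * y = a - 3/2\<close>, the factors
      \<open>K + 1/2 + 3 * y\<close> and \<open>K + 1/2 - 3 * y\<close> become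
      \<open>K + a - 1\<close> and \<open>K + 2 - a\<close>.\<close>
    have f: "((K + 1/2)\<^sup>2 / 9 - y\<^sup>2) / ((K + 1)\<^sup>2 - y\<^sup>2) =
       (K + a - 1) * (K + 2 - a) / (9 * (K + 1 + y) * (K + 1 - y))"
    proof -
      have "(K + 1/2)\<^sup>2 / 9 - y\<^sup>2 = (K + a - 1) * (K + 2 - a) / 9"
        unfolding a_def by (simp add: power2_eq_square field_simps)
      moreover have "(K + 1)\<^sup>2 - y\<^sup>2 = (K + 1 + y) * (K + 1 - y)" by (simp add: power2_eq_square algebra_simps)
      ultimately show ?thesis by (simp only: divide_divide_eq_left mult.assoc)
    qed
    show ?case
      unfolding ram_prod_Suc Suc.IH X_Suc of_nat_Suc K_def[symmetric] f
      using n[of k, folded K_def] a0 y0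
      by (simp add: divide_simps) (simp add: algebra_simps)
  qed
  show "ram_prod k ((y + 1)\<^sup>2) = - (1 + y) * X k * (a + of_nat k) * (a + of_nat k + 1)
            / (a * (of_nat k - 1 - a) * (of_nat k + 1 + y))"
  proof (induction k)
    case 0
    have "a * (0 - 1 - a) * (0 + 1 + y) \<noteq> 0" using n(3,9)[of 0] a0 by simp
    moreover have "- (1 + y) * 1 * (a + 0) * (a + 0 + 1) = a * (0 - 1 - a) * (0 + 1 + y)"
      by (simp add: algebra_simps)
    ultimately have "- (1 + y) * 1 * (a + 0) * (a + 0 + 1) / (a * (0 - 1 - a) * (0 + 1 + y)) = 1"
      by (metis divide_self)
    then show ?case unfolding X_def by (simp only: ram_prod_def) simp
  next
    case (Suc k)
    define K where "K = (of_nat k :: complex)"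
    \<comment> \<open>The same factorisation with \<open>3 * (y + 1) = a + 3/2\<close>.\<close>
    have f: "((K + 1/2)\<^sup>2 / 9 - (y+1)\<^sup>2) / ((K + 1)\<^sup>2 - (y+1)\<^sup>2) =
       (K + a + 2) * (K - 1 - a) / (9 * (K + 2 + y) * (K - y))"
    proof -
      have "(K + 1/2)\<^sup>2 / 9 - (y+1)\<^sup>2 = (K + a + 2) * (K - 1 - a) / 9"
        unfolding a_def by (simp add: power2_eq_square field_simps)
      moreover have "(K + 1)\<^sup>2 - (y+1)\<^sup>2 = (K + 2 + y) * (K - y)" by (simp add: power2_eq_square algebra_simps)
      ultimately show ?thesis by (simp only: divide_divide_eq_left mult.assoc)
    qed
    show ?case
      unfolding ram_prod_Suc Suc.IH X_Suc of_nat_Suc K_def[symmetric] f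
      using n[of k, folded K_def] a0 y0
      by (simp add: divide_simps del: distrib_left_numeral right_diff_distrib_numeral) (simp add: algebra_simps)
  qed
qed

lemma tendsto_linear_ratio:
  "(\<lambda>k. (of_nat k + p) / (of_nat k + q) :: complex) \<longlonglongrightarrow> 1"
proof -
  have z: "(\<lambda>k. c / of_nat k :: complex) \<longlonglongrightarrow> 0" for c
    by (rule tendsto_divide_0[OF tendsto_const tendsto_of_nat])
  have "(\<lambda>k. (1 + p / of_nat k) / (1 + q / of_nat k) :: complex) \<longlonglongrightarrow> (1 + 0) / (1 + 0)"
    by (intro tendsto_intros z) auto
  moreover have "\<forall>\<^sub>F k in sequentially.
      (1 + p / of_nat k) / (1 + q / of_nat k) = (of_nat k + p) / (of_nat k + q)"
  proof (rule eventually_sequentiallyI[of 1])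
    fix k :: nat assume "1 \<le> k"
    then have k: "of_nat k \<noteq> (0::complex)" by simp
    have "(1 + p / of_nat k) / (1 + q / of_nat k) =
        (of_nat k * (1 + p / of_nat k)) / (of_nat k * (1 + q / of_nat k))"
      using k by simp
    also have "\<dots> = (of_nat k + p) / (of_nat k + q)" using k by (simp add: distrib_left)
    finally show "(1 + p / of_nat k) / (1 + q / of_nat k) = (of_nat k + p) / (of_nat k + q)" .
  qed
  ultimately have "(\<lambda>k. (of_nat k + p) / (of_nat k + q) :: complex) \<longlonglongrightarrow> (1 + 0) / (1 + 0)"
    by (rule Lim_transform_eventually)
  then show ?thesis by simp
qed

text \<open>The termwise difference of the two sides is \<open>G (Suc k) - G k\<close>, where
  \<open>G\<close> starts at 0 and tends to 0, so it sums to 0. The bounds on the real part put both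
  \<open>y\<close> and \<open>y + 1\<close> in the strip where the series is known to converge; a
  nonzero imaginary part keeps all denominators of the certificate away from 0.\<close>

lemma ram_series_shift_nonreal:
  fixes y :: complex
  assumes im: "Im y \<noteq> 0" and re: "-1 < Re y" "Re y < 0"
  shows "ram_series ((y + 1)\<^sup>2) / (y + 1) = ram_series (y\<^sup>2) / y"
proof -
  define a where "a = 3 * y + 3/2"
  define X where "X k = pochhammer a k * pochhammer (- a) k / (9 ^ k * pochhammer (1 + y) k * pochhammer (- y) k)" for k
  note aux = ram_prod_shift[of y a X, OF im a_def X_def]
  \<comment> \<open>the WZ certificate, found by Gosper's algorithm\<close>
  define G where "G = (\<lambda>k. 24 * of_nat k * (2 * of_nat k - 1) * ram_coeff k * X k / ((of_nat k - 1 - a) * (of_nat k - 1 + a)))"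
  have a0: "a \<noteq> 0" using im by (auto simp: a_def complex_eq_iff)
  have y0: "y \<noteq> 0" "y + 1 \<noteq> 0" using im by (auto simp: complex_eq_iff)
  have n: "of_nat n - a \<noteq> 0" "of_nat n + 1 - a \<noteq> 0" "of_nat n - 1 - a \<noteq> 0" "of_nat n + a \<noteq> 0"
     "of_nat n - 1 + a \<noteq> 0" "a + of_nat n - 1 \<noteq> 0"
     "of_nat n - y \<noteq> 0" "of_nat n + 1 + y \<noteq> 0" "1 + y + of_nat n \<noteq> 0" for n :: nat
    using im by (auto simp: a_def complex_eq_iff)
  have step: "ram_term k ((y + 1)\<^sup>2) / (y + 1) - ram_term k (y\<^sup>2) / y = G (Suc k) - G k" for k
  proof -
    define K where "K = (of_nat k :: complex)"
    note nk = n[of k, folded K_def]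
    \<comment> \<open>The factor \<open>(2 * K + 1) * (2 * K + 2)\<close> cancels against the
      recurrence of \<open>ram_coeff\<close>, and \<open>(a + K) * (K - a)\<close> against that of
      \<open>X\<close>.\<close>
    have G1: "G (Suc k) = ram_coeff k * X k * (12 * (2 * K + 1/2) * (2 * K + 3/2) / (9 * (K + 1 + y) * (K - y)))"
    proof -
      have cancel: "12 * M * (c * (p / M)) * (x * (R / E)) / R = c * x * (12 * p / E)"
        if "M \<noteq> 0" "R \<noteq> 0" for M c p x R E :: complex using that by simp
      have e: "24 * (1 + K) * (2 * (1 + K) - 1) = 12 * ((2 * K + 1) * (2 * K + 2))"
        "(1 + K - 1 - a) * (1 + K - 1 + a) = (a + K) * (K - a)"
        "9 * (1 + y + K) * (K - y) = 9 * (K + 1 + y) * (K - y)"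
        by (simp_all add: algebra_simps)
      have M: "(2 * K + 1) * (2 * K + 2) \<noteq> 0"
        unfolding K_def by (auto simp: complex_eq_iff)
      have R: "(a + K) * (K - a) \<noteq> 0" using nk by (simp add: add.commute)
      show ?thesis
        unfolding G_def aux(3) ram_coeff_Suc of_nat_Suc K_def[symmetric] e
          mult.assoc[of 12 "2 * K + 1/2"]
        by (rule cancel[OF M R])
    qed
    have G0: "G k = ram_coeff k * X k * (24 * K * (2 * K - 1) / ((K - 1 - a) * (K - 1 + a)))"
      unfolding G_def K_def by simp
    have T1: "ram_term k ((y + 1)\<^sup>2) / (y + 1) = ram_coeff k * X k *
        (- (8 * K + 1) * (K + a) * (K + a + 1) / (a * (K - 1 - a) * (K + 1 + y)))"
      unfolding ram_term_def aux(2) K_def[symmetric] using y0 by (simp add: divide_simps) (simp add: algebra_simps)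
    have T0: "ram_term k (y\<^sup>2) / y = ram_coeff k * X k *
        (- (8 * K + 1) * (K - a) * (K + 1 - a) / (a * (K - 1 + a) * (K - y)))"
      unfolding ram_term_def aux(1) K_def[symmetric] using y0 by (simp add: divide_simps) (simp add: algebra_simps)
    \<comment> \<open>With the common factor \<open>ram_coeff k * X k\<close> removed, the
      telescoping relation is an identity of rational functions in \<open>K\<close> and
      \<open>y\<close>, checked by multiplying with the common denominator \<open>D\<close>.\<close>
    have "(- (8 * K + 1) * (K + a) * (K + a + 1) / (a * (K - 1 - a) * (K + 1 + y))) -
        (- (8 * K + 1) * (K - a) * (K + 1 - a) / (a * (K - 1 + a) * (K - y))) =
       (12 * (2 * K + 1/2) * (2 * K + 3/2) / (9 * (K + 1 + y) * (K - y))) -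
       (24 * K * (2 * K - 1) / ((K - 1 - a) * (K - 1 + a)))" (is "?l1 - ?l2 = ?r1 - ?r2")
    proof -
      have cancel: "p / (9 * A * B) * (q * A * B) = p / 9 * q"
        if "A \<noteq> 0" "B \<noteq> 0" for p q A B :: complex
        using that by (simp add: field_simps)
      define D where "D = a * (K - 1 - a) * (K - 1 + a) * (K + 1 + y) * (K - y)"
      have D: "D \<noteq> 0" using nk a0 by (simp add: D_def)
      have "?l1 * D = - (8 * K + 1) * (K + a) * (K + a + 1) * ((K - 1 + a) * (K - y))"
        using nk a0 by (simp add: D_def)
      moreover have "?l2 * D = - (8 * K + 1) * (K - a) * (K + 1 - a) * ((K - 1 - a) * (K + 1 + y))"
        using nk a0 by (simp add: D_def)
      moreover have "?r1 * D = 12 * (2 * K + 1/2) * (2 * K + 3/2) / 9 * (a * (K - 1 - a) * (K - 1 + a))"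
        unfolding D_def by (rule cancel) (use nk in auto)
      moreover have "?r2 * D = 24 * K * (2 * K - 1) * (a * (K + 1 + y) * (K - y))"
        using nk a0 by (simp add: D_def)
      moreover have "- (8 * K + 1) * (K + a) * (K + a + 1) * ((K - 1 + a) * (K - y)) -
         (- (8 * K + 1) * (K - a) * (K + 1 - a) * ((K - 1 - a) * (K + 1 + y))) =
         12 * (2 * K + 1/2) * (2 * K + 3/2) / 9 * (a * (K - 1 - a) * (K - 1 + a)) -
          24 * K * (2 * K - 1) * (a * (K + 1 + y) * (K - y))"
        unfolding a_def by (simp add: field_simps)
      ultimately have "(?l1 - ?l2) * D = (?r1 - ?r2) * D" by (simp only: left_diff_distrib)
      then show ?thesis using D by simp
    qed
    then show ?thesis unfolding G1 G0 T1 T0 by (simp only: right_diff_distrib[symmetric])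
  qed
  have s0: "(\<lambda>k. ram_term k (y\<^sup>2)) sums ram_series (y\<^sup>2)"
    using re by (intro ram_term_sums square_in_slit_plane) auto
  have s1: "(\<lambda>k. ram_term k ((y+1)\<^sup>2)) sums ram_series ((y+1)\<^sup>2)"
    using re by (intro ram_term_sums square_in_slit_plane) auto
  have "(\<lambda>k. ram_term k ((y + 1)\<^sup>2) / (y + 1) - ram_term k (y\<^sup>2) / y) sums
      (ram_series ((y + 1)\<^sup>2) / (y + 1) - ram_series (y\<^sup>2) / y)"
    by (intro sums_diff sums_divide s0 s1)
  \<comment> \<open>Up to the constant \<open>- 48 * a / y\<close>, the certificate is
    \<open>ram_coeff k * ram_prod k (y^2)\<close> times three linear quotients that tend to 1. The
    former product tends to 0 because it is dominated by the terms of a convergent series.\<close>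
  moreover have "G \<longlonglongrightarrow> 0"
  proof -
    have t0: "(\<lambda>k. ram_term k (y\<^sup>2)) \<longlonglongrightarrow> 0"
      using s0 sums_summable summable_LIMSEQ_zero by blast
    have cp: "(\<lambda>k. ram_coeff k * ram_prod k (y\<^sup>2)) \<longlonglongrightarrow> 0"
    proof (rule Lim_null_comparison[OF _ tendsto_norm_zero[OF t0]])
      have "norm (ram_coeff k * ram_prod k (y\<^sup>2)) \<le> norm (ram_term k (y\<^sup>2))" for k
        using mult_right_mono[of 1 "8 * real k + 1" "norm (ram_coeff k * ram_prod k (y\<^sup>2))"]
        by (simp add: ram_term_def norm_mult norm_linear_nat mult.assoc)
      then show "\<forall>\<^sub>F k in sequentially. norm (ram_coeff k * ram_prod k (y\<^sup>2)) \<le> norm (ram_term k (y\<^sup>2))"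
        by simp
    qed
    have "(\<lambda>k. (- 48 * a / y) * (ram_coeff k * ram_prod k (y\<^sup>2)) *
        (((of_nat k + 0) / (of_nat k + (-1 - a))) * ((of_nat k + (- (1/2))) / (of_nat k + (- a)))
          * ((of_nat k + (- y)) / (of_nat k + (1 - a))))) \<longlonglongrightarrow> (- 48 * a / y) * 0 * (1 * 1 * 1)"
      by (intro tendsto_mult tendsto_const cp tendsto_linear_ratio)
    moreover have "(- 48 * a / y) * (ram_coeff k * ram_prod k (y\<^sup>2)) *
        (((of_nat k + 0) / (of_nat k + (-1 - a))) * ((of_nat k + (- (1/2))) / (of_nat k + (- a)))
          * ((of_nat k + (- y)) / (of_nat k + (1 - a)))) = G k" for k
    proof -
      define K where "K = (of_nat k :: complex)"
      note nk = n[of k, folded K_def]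
      have e: "K + (-1 - a) = K - 1 - a" "K + (- (1/2)) = (2 * K - 1) / 2" "K + (- a) = K - a"
        "K + (- y) = K - y" "K + (1 - a) = K + 1 - a" "a + K - 1 = K - 1 + a" by (simp_all add: field_simps)
      show ?thesis
        unfolding G_def aux(1) K_def[symmetric] e
        using nk a0 y0 by (simp add: divide_simps)
    qed
    ultimately show ?thesis by simp
  qed
  then have "(\<lambda>k. G (Suc k) - G k) sums (0 - G 0)" by (rule telescope_sums)
  moreover have "G 0 = 0" by (simp add: G_def)
  ultimately show ?thesis by (simp add: step sums_iff)
qed

section \<open>Growth estimates for the series and the cotangent\<close>

text \<open>A point of the closed left half-plane is no farther from \<open>A\<close> than from
  \<open>B\<close> when \<open>0 \<le> A \<le> B\<close>. This controls the initial terms, where the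
  factors need not yet be below 1/2.\<close>

lemma norm_ratio_le_1:
  fixes u :: complex
  assumes "Re u \<le> 0"
  shows "norm (((of_nat i + 1/2)\<^sup>2 / 9 - u) / ((of_nat i + 1)\<^sup>2 - u)) \<le> 1"
proof -
  define A B where "A = (real i + 1/2)\<^sup>2 / 9" and "B = (real i + 1)\<^sup>2"
  have AB: "0 \<le> A" "A \<le> B"
  proof -
    have "(real i + 1/2)\<^sup>2 \<le> (real i + 1)\<^sup>2" by (intro power_mono) auto
    then show "A \<le> B" using zero_le_power2[of "real i + 1"] unfolding A_def B_def by linarith
  qed (simp add: A_def)
  have eq: "(of_nat i + 1/2)\<^sup>2 / 9 = complex_of_real A" "(of_nat i + 1)\<^sup>2 = complex_of_real B"
    by (simp_all add: A_def B_def)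
  have "norm (of_real A - u) \<le> norm (of_real B - u)"
  proof -
    have "(A - Re u)\<^sup>2 \<le> (B - Re u)\<^sup>2" using AB assms by (intro power_mono) auto
    then show ?thesis by (simp add: cmod_def)
  qed
  then show ?thesis unfolding eq by (simp add: norm_divide divide_le_eq_1)
qed

lemma norm_ram_prod_le_1:
  assumes "Re u \<le> 0"
  shows "norm (ram_prod k u) \<le> 1"
  unfolding ram_prod_def prod_norm[symmetric]
  by (intro prod_le_1 conjI norm_ge_zero norm_ratio_le_1 assms)

text \<open>The sum is cut at an index \<open>N\<close> comparable to \<open>norm y\<close>. Below
  \<open>N\<close> all products have norm at most 1, so the head is of order \<open>N^2\<close>;
  from \<open>N\<close> on the products decay geometrically, so the tail is of order
  \<open>N\<close>.\<close>

lemma ram_series_growth: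
  obtains C where "C > 0" "\<And>y. Re (y\<^sup>2) \<le> 0 \<Longrightarrow> 1 \<le> norm y \<Longrightarrow> norm (ram_series (y\<^sup>2)) \<le> C * norm y ^ 2"
proof -
  define S where "S = (\<Sum>j. (1 + 8 * real j) * (1/2)^j)"
  have S_sums: "(\<lambda>j. (1 + 8 * real j) * (1/2)^j) sums S"
    unfolding S_def using summable_linear_geometric summable_sums by blast
  have S0: "S \<ge> 0" unfolding S_def by (intro suminf_nonneg summable_linear_geometric) auto
  have "norm (ram_series (y\<^sup>2)) \<le> (25 * (3 + S)) * norm y ^ 2"
    if re: "Re (y\<^sup>2) \<le> 0" and y1: "1 \<le> norm y" for y
  proof -
    \<comment> \<open>\<open>N\<close> at least \<open>2 * norm y\<close> is what the ratio bound
      1/2 requires at \<open>u = y^2\<close>; rounding up costs at most one further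
      \<open>norm y\<close>, as \<open>1 \<le> norm y\<close>.\<close>
    define N where "N = nat \<lceil>2 * norm y\<rceil>"
    have N: "2 * norm y \<le> real N" "real N \<le> 3 * norm y"
      unfolding N_def using y1 by linarith+
    have big: "4 * norm (y\<^sup>2) \<le> (real i + 1)\<^sup>2" if "i \<ge> N" for i
    proof -
      have "2 * norm y \<le> real i + 1" using N that by linarith
      then have "(2 * norm y)\<^sup>2 \<le> (real i + 1)\<^sup>2" by (intro power_mono) auto
      then show ?thesis by (simp add: norm_power power_mult_distrib)
    qed
    have in_slit: "y\<^sup>2 \<in> slit_plane" using re by (auto simp: slit_plane_def)
    have head: "norm (\<Sum>k<N. ram_term k (y\<^sup>2)) \<le> real N * (8 * real N + 1)"
    proof -
      have "norm (ram_term k (y\<^sup>2)) \<le> 8 * real N + 1" if "k < N" for k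
      proof -
        have "norm (ram_term k (y\<^sup>2)) \<le> (8 * real k + 1) * 1"
          by (intro order_trans[OF norm_ram_term_le] mult_left_mono norm_ram_prod_le_1 re) auto
        then show ?thesis using that by simp
      qed
      then show ?thesis
        using sum_norm_bound[of "{..<N}" "\<lambda>k. ram_term k (y\<^sup>2)" "8 * real N + 1"] by simp
    qed
    have tail_bound: "norm (ram_term (j + N) (y\<^sup>2)) \<le> (8 * real N + 1) * ((1 + 8 * real j) * (1/2)^j)" for j
    proof -
      have "norm (ram_prod (N + j) (y\<^sup>2)) \<le> norm (ram_prod N (y\<^sup>2)) * (1/2)^j"
        by (rule ram_prod_tail_bound) (rule big)
      also have "\<dots> \<le> 1 * (1/2)^j"
        by (intro mult_right_mono norm_ram_prod_le_1 re) auto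
      finally have "norm (ram_term (j + N) (y\<^sup>2)) \<le> (8 * real (j + N) + 1) * (1/2)^j"
        by (intro order_trans[OF norm_ram_term_le] mult_left_mono) (auto simp: add.commute)
      also have "\<dots> \<le> ((8 * real N + 1) * (1 + 8 * real j)) * (1/2)^j"
        by (intro mult_right_mono) (auto simp: algebra_simps)
      finally show ?thesis by (simp add: mult.assoc)
    qed
    have tail: "norm (\<Sum>j. ram_term (j + N) (y\<^sup>2)) \<le> (8 * real N + 1) * S"
    proof -
      have s: "(\<lambda>j. (8 * real N + 1) * ((1 + 8 * real j) * (1/2)^j)) sums ((8 * real N + 1) * S)"
        by (intro sums_mult S_sums)
      have "norm (\<Sum>j. ram_term (j + N) (y\<^sup>2)) \<le> (\<Sum>j. (8 * real N + 1) * ((1 + 8 * real j) * (1/2)^j))"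
        by (intro norm_suminf_le tail_bound sums_summable[OF s])
      then show ?thesis using s by (simp add: sums_iff)
    qed
    have split: "ram_series (y\<^sup>2) = (\<Sum>j. ram_term (j + N) (y\<^sup>2)) + (\<Sum>k<N. ram_term k (y\<^sup>2))"
      unfolding ram_series_def
      using ram_term_sums[OF in_slit] by (intro suminf_split_initial_segment) (rule sums_summable)
    have "norm (ram_series (y\<^sup>2)) \<le> (8 * real N + 1) * S + real N * (8 * real N + 1)"
      using norm_triangle_ineq[of "\<Sum>j. ram_term (j + N) (y\<^sup>2)" "\<Sum>k<N. ram_term k (y\<^sup>2)"] head tail
      unfolding split by linarith
    also have "\<dots> = (8 * real N + 1) * (real N + S)" by (simp add: algebra_simps)
    also have "\<dots> \<le> (25 * norm y) * ((3 + S) * norm y)"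
    proof (rule mult_mono)
      show "8 * real N + 1 \<le> 25 * norm y" using N y1 by linarith
      have "S * 1 \<le> S * norm y" using S0 y1 by (intro mult_left_mono) auto
      then show "real N + S \<le> (3 + S) * norm y" using N by (simp add: algebra_simps)
    qed (use S0 in auto)
    finally show ?thesis by (simp add: power2_eq_square mult_ac)
  qed
  moreover have "25 * (3 + S) > 0" using S0 by simp
  ultimately show ?thesis using that by blast
qed

text \<open>With \<open>E = 2 cosh (2 Im w)\<close>, four times the squared norms of sine and cosine
  are \<open>E - 2c\<close> and \<open>E + 2c\<close>, where \<open>c = cos (2 Re w)\<close>. As
  \<open>E\<close> is at least 5 and \<open>c\<close> at most 1, \<open>E + 2c\<close> is at most
  \<open>4 (E - 2c)\<close>.\<close>

lemma norm_cot_le: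
  fixes w :: complex
  assumes "\<bar>Im w\<bar> \<ge> 2"
  shows "norm (cot w) \<le> 2"
proof -
  define E where "E = exp (2 * Im w) + inverse (exp (2 * Im w))"
  have E: "E \<ge> 5"
  proof (cases "Im w \<ge> 0")
    case True
    then have "1 + 2 * Im w \<le> exp (2 * Im w)" "0 < inverse (exp (2 * Im w))" "Im w \<ge> 2"
      using assms exp_ge_add_one_self by auto
    then show ?thesis unfolding E_def by linarith
  next
    case False
    then have "1 - 2 * Im w \<le> inverse (exp (2 * Im w))" "0 < exp (2 * Im w)" "Im w \<le> -2"
      using assms exp_ge_add_one_self[of "- 2 * Im w"] by (auto simp: exp_minus)
    then show ?thesis unfolding E_def by linarith
  qed
  have s: "norm (sin w) ^ 2 = (E - 2 * cos (2 * Re w)) / 4"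
    unfolding norm_sin_squared E_def by simp
  have c: "norm (cos w) ^ 2 = (E + 2 * cos (2 * Re w)) / 4"
    \<comment> \<open>The cosine is the sine shifted by a quarter period, which flips the sign of
      \<open>cos (2 * Re w)\<close>.\<close>
    using norm_sin_squared[of "w + of_real pi / 2"]
    by (simp add: E_def sin_add distrib_left)
  have "(E + 2 * cos (2 * Re w)) / 4 \<le> 4 * ((E - 2 * cos (2 * Re w)) / 4)"
    using E cos_le_one[of "2 * Re w"] by argo
  then have "norm (cos w) ^ 2 \<le> (2 * norm (sin w)) ^ 2"
    by (simp add: power_mult_distrib s c)
  then have "norm (cos w) \<le> 2 * norm (sin w)" by (rule power2_le_imp_le) simp
  then show ?thesis
    by (cases "sin w = 0") (simp_all add: cot_def norm_divide divide_le_eq)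
qed

section \<open>Identification with the cotangent\<close>

lemma sin_pi_nonzero_in_strip:
  fixes y :: complex
  assumes "\<bar>Re y\<bar> < 1" "y \<noteq> 0"
  shows "sin (of_real pi * y) \<noteq> 0"
proof
  assume "sin (of_real pi * y) = 0"
  then obtain n :: int where "of_real pi * y = of_real (of_int n * pi)"
    by (auto simp: sin_eq_0)
  then have "of_real pi * y = of_real pi * of_int n" by (simp add: mult.commute)
  then have "y = of_int n" by simp
  then show False using assms by auto
qed

text \<open>A real \<open>y\<close> is approached vertically by the nonreal points
  \<open>y + s n\<close>, where the shift relation is known; both sides are continuous at
  \<open>y\<close> and \<open>y + 1\<close>, which are nonzero points of the strip.\<close>

lemma ram_series_shift:
  fixes y :: complex
  assumes re: "-1 < Re y" "Re y < 0"
  shows "ram_series ((y + 1)\<^sup>2) / (y + 1) = ram_series (y\<^sup>2) / y"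
proof (cases "Im y = 0")
  case False
  then show ?thesis using ram_series_shift_nonreal re by blast
next
  case True
  define \<phi> where "\<phi> = (\<lambda>y. ram_series (y\<^sup>2) / y)"
  define s where "s = (\<lambda>n. \<i> * of_real (inverse (real (Suc n))))"
  have s: "s \<longlonglongrightarrow> 0"
    unfolding s_def using tendsto_of_real[OF LIMSEQ_inverse_real_of_nat, where 'a = complex]
    by (intro tendsto_mult_right_zero) simp
  have cont: "(\<lambda>n. \<phi> (w + s n)) \<longlonglongrightarrow> \<phi> w" if w: "\<bar>Re w\<bar> < 1" "w \<noteq> 0" for w
  proof -
    have "isCont ram_series (w\<^sup>2)"
      using holomorphic_on_imp_continuous_on[OF ram_series_holomorphic]
        continuous_on_eq_continuous_at[OF open_slit_plane] square_in_slit_plane[OF w(1)]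
      by blast
    moreover have "isCont (\<lambda>y. y\<^sup>2) w" by (intro continuous_intros)
    ultimately have "isCont (\<lambda>y. ram_series (y\<^sup>2)) w" by (rule isCont_o2[rotated])
    then have "isCont \<phi> w"
      unfolding \<phi>_def by (rule continuous_at_within_divide[OF _ continuous_ident w(2)])
    moreover have "(\<lambda>n. w + s n) \<longlonglongrightarrow> w" using tendsto_add[OF tendsto_const s, of w] by simp
    ultimately show ?thesis by (rule isCont_tendsto_compose)
  qed
  have "\<phi> (y + 1 + s n) = \<phi> (y + s n)" for n
    using ram_series_shift_nonreal[of "y + s n"] re True
    by (simp add: \<phi>_def s_def add_ac)
  moreover have "(\<lambda>n. \<phi> (y + s n)) \<longlonglongrightarrow> \<phi> y" "(\<lambda>n. \<phi> (y + 1 + s n)) \<longlonglongrightarrow> \<phi> (y + 1)"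
    using re by (auto intro!: cont simp: complex_eq_iff)
  ultimately have "\<phi> (y + 1) = \<phi> y" using LIMSEQ_unique by simp
  then show ?thesis by (simp add: \<phi>_def)
qed

text \<open>The constant \<open>ram_series 0\<close> is still unknown here. The point
  \<open>y = 0\<close> has to be excluded because \<open>cot 0 = 0\<close> in HOL.\<close>

lemma ram_series_eq_cot:
  assumes y: "\<bar>Re y\<bar> < 1" "y \<noteq> 0"
  shows "ram_series (y\<^sup>2) = ram_series 0 * (of_real pi * y * cot (of_real pi * y))"
proof -
  define L where "L = ram_series 0"
  define strip where "strip = {y. \<bar>Re y\<bar> < 1}"
  \<comment> \<open>Both parts have residue \<open>L\<close> at 0, so the difference has a removable
    singularity there.\<close>
  define f where "f = (\<lambda>y. ram_series (y\<^sup>2) / y - of_real pi * L * cot (of_real pi * y))"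
  have open_strip: "open strip"
    unfolding strip_def by (intro open_Collect_less continuous_intros)
  have holo_sq: "(\<lambda>y. ram_series (y\<^sup>2)) holomorphic_on strip"
  proof -
    have "(ram_series \<circ> (\<lambda>y. y\<^sup>2)) holomorphic_on strip"
      by (rule holomorphic_on_compose_gen[OF _ ram_series_holomorphic])
         (auto simp: strip_def intro!: holomorphic_intros square_in_slit_plane)
    then show ?thesis by (simp only: o_def)
  qed
  have "f holomorphic_on strip - {0}"
    unfolding f_def cot_def
    by (intro holomorphic_intros holomorphic_on_subset[OF holo_sq])
       (auto simp: strip_def sin_pi_nonzero_in_strip)
  moreover have "((\<lambda>z. (z - 0) * f z) \<longlongrightarrow> 0) (at 0)"
  proof -
    have "isCont (\<lambda>y. ram_series (y\<^sup>2)) 0"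
      using holo_sq open_strip by (auto simp: strip_def continuous_on_eq_continuous_at dest!: holomorphic_on_imp_continuous_on)
    then have 1: "((\<lambda>y. ram_series (y\<^sup>2)) \<longlongrightarrow> L) (at 0)" by (simp add: isCont_def L_def)
    have "((\<lambda>z. sin (of_real pi * z :: complex)) has_field_derivative of_real pi) (at 0)"
      by (auto intro!: derivative_eq_intros)
    then have 2: "((\<lambda>z. sin (of_real pi * z :: complex) / z) \<longlongrightarrow> of_real pi) (at 0)"
      by (simp add: has_field_derivative_iff)
    have 3: "((\<lambda>z. cos (of_real pi * z :: complex)) \<longlongrightarrow> 1) (at 0)"
      by (auto intro!: tendsto_eq_intros)
    have "((\<lambda>z. ram_series (z\<^sup>2) - of_real pi * L * (cos (of_real pi * z) / (sin (of_real pi * z) / z)))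
        \<longlongrightarrow> L - of_real pi * L * (1 / of_real pi)) (at 0)"
      by (intro tendsto_intros 1 2 3) auto
    moreover have "\<forall>\<^sub>F z in at 0. ram_series (z\<^sup>2) - of_real pi * L * (cos (of_real pi * z) / (sin (of_real pi * z) / z)) = (z - 0) * f z"
      by (rule eventually_mono[OF eventually_at_ball'[of 1 0 UNIV]]) (auto simp: f_def cot_def field_simps)
    ultimately show ?thesis using tendsto_cong by fastforce
  qed
  ultimately obtain F where F: "F holomorphic_on strip" "\<And>z. z \<in> strip - {0} \<Longrightarrow> F z = f z"
    using holomorphic_on_extend_lim[of f strip 0] open_strip
    by (auto simp: interior_open strip_def)
  have F_shift: "F (z + 1) = F z" if "-1 < Re z" "Re z < 0" for z
  proof -
    have "cot (of_real pi * (z + 1)) = cot (of_real pi * z)"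
      by (simp add: cot_def distrib_left sin_add cos_add flip: sin_of_real cos_of_real)
    moreover have "z \<in> strip - {0}" "z + 1 \<in> strip - {0}"
      using that by (auto simp: strip_def complex_eq_iff)
    ultimately show ?thesis using ram_series_shift[OF that] F(2) by (simp add: f_def)
  qed
  \<comment> \<open>The 1-periodic extension of \<open>F\<close> to the plane, using the
    representative of \<open>z\<close> with real part between -1/2 and 1/2.\<close>
  define h where "h = (\<lambda>z. F (z - of_int (round (Re z))))"
  \<comment> \<open>Every translate of \<open>F\<close> whose strip contains \<open>z\<close> gives
    the same value. Near a given point a single fixed \<open>n\<close> can therefore be used, which
    removes the jumps of \<open>round\<close> and shows that \<open>h\<close> is entire.\<close>
  have h_eq: "h z = F (z - of_int n)" if n: "\<bar>Re z - of_int n\<bar> < 1" for z n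
  proof -
    define m where "m = round (Re z)"
    have m: "\<bar>of_int m - Re z\<bar> \<le> 1/2" unfolding m_def by (rule of_int_round_abs_le)
    consider "m = n" | "m = n + 1" | "m = n - 1" using m n by linarith
    then show ?thesis
    proof cases
      case 2
      then have eq: "z - of_int n = (z - of_int m) + 1" by simp
      have "F (z - of_int n) = F (z - of_int m)"
        unfolding eq by (rule F_shift) (use m n 2 in auto)
      then show ?thesis by (simp only: h_def m_def)
    next
      case 3
      then have eq: "z - of_int m = (z - of_int n) + 1" by simp
      have "F (z - of_int m) = F (z - of_int n)"
        unfolding eq by (rule F_shift) (use m n 3 in auto)
      then show ?thesis by (simp only: h_def m_def)
    qed (simp add: h_def m_def)
  qed
  have "h holomorphic_on UNIV"
  proof -
    have "h field_differentiable at z" for z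
    proof -
      define n where "n = round (Re z)"
      have n: "\<bar>Re z - of_int n\<bar> < 1" using of_int_round_abs_le[of "Re z"] unfolding n_def by linarith
      define V where "V = {w. \<bar>Re w - of_int n\<bar> < 1}"
      have V: "open V" unfolding V_def by (intro open_Collect_less continuous_intros)
      have "(F \<circ> (\<lambda>w. w - of_int n)) holomorphic_on V"
        by (rule holomorphic_on_compose_gen[OF _ F(1)]) (auto intro!: holomorphic_intros simp: V_def strip_def)
      then have "h holomorphic_on V"
        by (rule holomorphic_transform) (simp add: V_def h_eq)
      then show ?thesis using V n by (auto simp: V_def holomorphic_on_open field_differentiable_def)
    qed
    then show ?thesis by (simp add: holomorphic_on_def)
  qed
  \<comment> \<open>After division by \<open>y\<close> the quadratic bound on the series becomes
    linear, so Liouville's theorem will leave a polynomial of degree at most 1. Imaginary parts up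
    to 1 are covered by compactness of a box, larger ones by the two growth estimates.\<close>
  moreover obtain B where "\<And>z. 1 \<le> norm z \<Longrightarrow> norm (h z) \<le> B * norm z ^ 1"
  proof -
    have "compact (F ` cbox (Complex (-1/2) (-1)) (Complex (1/2) 1))"
      by (intro compact_continuous_image compact_cbox
            continuous_on_subset[OF holomorphic_on_imp_continuous_on[OF F(1)]])
         (auto simp: in_cbox_complex_iff strip_def)
    then have "bounded (F ` cbox (Complex (-1/2) (-1)) (Complex (1/2) 1))" by (rule compact_imp_bounded)
    then obtain M where M: "M > 0" "\<And>y. y \<in> cbox (Complex (-1/2) (-1)) (Complex (1/2) 1) \<Longrightarrow> norm (F y) \<le> M"
      unfolding bounded_pos by blast
    obtain C where C: "C > 0" "\<And>y. Re (y\<^sup>2) \<le> 0 \<Longrightarrow> 1 \<le> norm y \<Longrightarrow> norm (ram_series (y\<^sup>2)) \<le> C * norm y ^ 2"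
      using ram_series_growth by metis
    have "norm (h z) \<le> (M + 2 * C + 2 * pi * norm L) * norm z ^ 1" if z: "1 \<le> norm z" for z
    proof -
      define y where "y = z - of_int (round (Re z))"
      have re: "\<bar>Re y\<bar> \<le> 1/2" using of_int_round_abs_le[of "Re z"] unfolding y_def by (simp add: abs_minus_commute)
      have im: "Im y = Im z" by (simp add: y_def)
      have hz: "h z = F y" by (simp add: h_def y_def)
      have nonneg: "0 \<le> M * norm z" "0 \<le> C * norm z" "0 \<le> pi * norm L * norm z"
        using M(1) C(1) by auto
      have expand: "(M + 2 * C + 2 * pi * norm L) * norm z ^ 1 =
          M * norm z + 2 * (C * norm z) + 2 * (pi * norm L * norm z)"
        by (simp add: algebra_simps)
      show ?thesis
      proof (cases "\<bar>Im y\<bar> \<le> 1")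
        case True
        then have "norm (F y) \<le> M" using re by (intro M(2)) (auto simp: in_cbox_complex_iff)
        also have "\<dots> \<le> M * norm z" using M(1) z by simp
        finally show ?thesis using nonneg unfolding hz expand by linarith
      next
        case False
        have y1: "1 \<le> norm y" using False abs_Im_le_cmod[of y] by linarith
        have y0: "y \<in> strip - {0}" using re False by (auto simp: strip_def)
        \<comment> \<open>Reduction to real part at most 1/2 in absolute value places
          \<open>y^2\<close> in the left half-plane, as the growth bound demands.\<close>
        have "(Re y)\<^sup>2 \<le> (Im y)\<^sup>2" using re False by (intro abs_le_square_iff[THEN iffD1]) linarith
        then have "Re (y\<^sup>2) \<le> 0" by (simp add: power2_eq_square)
        then have "norm (ram_series (y\<^sup>2)) \<le> (C * norm y) * norm y"
          using C(2)[OF _ y1] by (simp add: power2_eq_square mult.assoc)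
        then have a: "norm (ram_series (y\<^sup>2) / y) \<le> C * norm y"
          unfolding norm_divide by (subst pos_divide_le_eq) (use y1 in auto)
        have "\<bar>Im (of_real pi * y)\<bar> \<ge> 2"
          using False mult_mono[of 2 pi 1 "\<bar>Im y\<bar>"] pi_ge_two by (simp add: abs_mult)
        then have "norm (of_real pi * L * cot (of_real pi * y)) \<le> (pi * norm L) * 2"
          unfolding norm_mult using norm_cot_le by (intro mult_mono) auto
        then have "norm (F y) \<le> C * norm y + (pi * norm L) * 2"
          using a norm_triangle_ineq4[of "ram_series (y\<^sup>2) / y" "of_real pi * L * cot (of_real pi * y)"]
          unfolding F(2)[OF y0] f_def by linarith
        moreover have "norm y \<le> 2 * norm z"
          using cmod_le[of y] re im abs_Im_le_cmod[of z] z by linarith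
        then have "C * norm y \<le> C * (2 * norm z)" using C(1) by (intro mult_left_mono) auto
        moreover have "(pi * norm L) * 2 * 1 \<le> (pi * norm L) * 2 * norm z"
          using z by (intro mult_left_mono) auto
        ultimately show ?thesis using nonneg unfolding hz expand by linarith
      qed
    qed
    then show ?thesis using that by blast
  qed
  ultimately have poly: "h z = (\<Sum>k\<le>1. (deriv^^k) h 0 / fact k * z ^ k)" for z
    using Liouville_polynomial[of h 1 B 1] by blast
  have affine: "h z = h 0 + deriv h 0 * z" for z
    by (subst poly) simp
  \<comment> \<open>Periodicity kills the linear coefficient.\<close>
  have "h 1 = h 0" by (simp add: h_def)
  then have "deriv h 0 = 0" using affine[of 1] by (metis add_cancel_left_right mult.right_neutral)
  then have h_const: "h z = h 0" for z using affine[of z] by (metis add.right_neutral mult_zero_left)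
  have const: "F z = h 0" if "z \<in> strip" for z
    unfolding h_const[of z, symmetric] using h_eq[of z 0] that by (simp add: strip_def)
  \<comment> \<open>Oddness of \<open>f\<close> at one sample pair of points forces the constant to
    be 0.\<close>
  have "F (1/4) = - F (-(1/4))"
    using F(2)[of "1/4"] F(2)[of "-(1/4)"] by (simp add: strip_def f_def cot_def power2_eq_square)
  then have "h 0 = 0" using const[of "1/4"] const[of "-(1/4)"] by (simp add: strip_def)
  then have "f y = 0" using const[of y] F(2)[of y] y by (simp add: strip_def)
  then show ?thesis using y by (simp add: f_def L_def field_simps)
qed

section \<open>Value and derivative of the series at zero\<close>

text \<open>At \<open>y = 1/6\<close> the factor with \<open>i = 0\<close> vanishes, so only the
  term \<open>k = 0\<close> survives and the series equals 1. Since \<open>cot (pi/6)\<close> is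
  \<open>sqrt 3\<close>, the cotangent identity then determines the constant.\<close>

lemma ram_series_0: "ram_series 0 = of_real (2 * sqrt 3 / pi)"
proof -
  have "ram_term k ((1/6)\<^sup>2) = 0" if "k \<noteq> 0" for k
  proof -
    have "ram_prod k ((1/6)\<^sup>2) = 0" unfolding ram_prod_def
      using that by (intro prod_zero) (auto intro!: bexI[of _ 0] simp: power2_eq_square)
    then show ?thesis by (simp add: ram_term_def)
  qed
  then have "(\<lambda>k. ram_term k ((1/6)\<^sup>2)) sums (\<Sum>k\<in>{0}. ram_term k ((1/6)\<^sup>2))"
    by (intro sums_finite) auto
  then have "ram_series ((1/6)\<^sup>2) = 1"
    by (simp add: ram_series_def sums_iff ram_term_def ram_coeff_def ram_prod_def)
  moreover have "cot (of_real pi * (1/6)) = complex_of_real (sqrt 3)"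
  proof -
    have "cot (of_real pi * (1/6)) = complex_of_real (cot (pi / 6))" by (simp add: cot_of_real)
    also have "cot (pi / 6) = sqrt 3" by (simp add: cot_def cos_30 sin_30)
    finally show ?thesis .
  qed
  ultimately have "ram_series 0 * (of_real pi * (1/6) * of_real (sqrt 3)) = 1"
    using ram_series_eq_cot[of "1/6"] by simp
  then have "ram_series 0 * of_real (pi * sqrt 3 / 6) = 1" by simp
  then have "ram_series 0 = 1 / of_real (pi * sqrt 3 / 6)"
    by (metis nonzero_eq_divide_eq mult_zero_right zero_neq_one)
  also have "\<dots> = of_real (1 / (pi * sqrt 3 / 6))" by simp
  also have "1 / (pi * sqrt 3 / 6) = 2 * sqrt 3 / pi" by (simp add: field_simps)
  finally show ?thesis .
qed

text \<open>From \<open>x cot x = 1 - x^2/3 + ...\<close> at \<open>x = pi * t\<close> with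
  \<open>u = t^2\<close>, the coefficient of \<open>u\<close> is \<open>2 sqrt 3 / pi\<close> times
  \<open>- pi^2 / 3\<close>.\<close>

lemma deriv_ram_series_0: "deriv ram_series 0 = of_real (- (2 * sqrt 3 * pi / 3))"
proof -
  define D where "D = deriv ram_series 0"
  have "(ram_series has_field_derivative D) (at 0)"
    unfolding D_def using holomorphic_derivI[OF ram_series_holomorphic open_slit_plane] by simp
  then have lim: "((\<lambda>w. (ram_series w - ram_series 0) / w) \<longlongrightarrow> D) (at 0)"
    by (simp add: has_field_derivative_iff)
  \<comment> \<open>The derivative exists by holomorphy, so it may be computed along
    \<open>u = t^2\<close> with real \<open>t\<close> decreasing to 0. This reduces it to a real
    limit.\<close>
  have "filterlim (\<lambda>t::real. complex_of_real (t\<^sup>2)) (at 0) (at_right 0)"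
    unfolding filterlim_at
    by (auto intro!: tendsto_eq_intros eventually_at_right_less[THEN eventually_mono])
  then have 1: "((\<lambda>t. (ram_series (of_real (t\<^sup>2)) - ram_series 0) / of_real (t\<^sup>2)) \<longlongrightarrow> D) (at_right 0)"
    using lim filterlim_compose by fastforce
  have "((\<lambda>t. (pi * t * (cos (pi * t) / sin (pi * t)) - 1) / t\<^sup>2) \<longlongrightarrow> - (pi\<^sup>2 / 3)) (at_right 0)"
    by real_asymp (simp add: field_simps power2_eq_square)
  then have 2: "((\<lambda>t. complex_of_real (2 * sqrt 3 / pi * ((pi * t * (cos (pi * t) / sin (pi * t)) - 1) / t\<^sup>2)))
      \<longlongrightarrow> of_real (2 * sqrt 3 / pi * (- (pi\<^sup>2 / 3)))) (at_right 0)"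
    by (intro tendsto_intros)
  have "\<forall>\<^sub>F t in at_right 0. t \<in> {0<..<1::real}"
    by (rule eventually_at_right_real) simp
  then have "\<forall>\<^sub>F t in at_right 0. (ram_series (of_real (t\<^sup>2)) - ram_series 0) / of_real (t\<^sup>2) =
      complex_of_real (2 * sqrt 3 / pi * ((pi * t * (cos (pi * t) / sin (pi * t)) - 1) / t\<^sup>2))"
  proof eventually_elim
    case (elim t)
    have "cot (of_real pi * of_real t) = complex_of_real (cos (pi * t) / sin (pi * t))"
      by (simp add: cot_def flip: sin_of_real cos_of_real)
    then have "ram_series (of_real (t\<^sup>2)) = of_real (2 * sqrt 3 / pi * (pi * t * (cos (pi * t) / sin (pi * t))))"
      using ram_series_eq_cot[of "of_real t"] elim unfolding ram_series_0 by simp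
    then show ?case unfolding ram_series_0 by (simp add: field_simps)
  qed
  then have "((\<lambda>t. complex_of_real (2 * sqrt 3 / pi * ((pi * t * (cos (pi * t) / sin (pi * t)) - 1) / t\<^sup>2)))
      \<longlongrightarrow> D) (at_right 0)"
    using 1 tendsto_cong by fastforce
  then have "D = of_real (2 * sqrt 3 / pi * (- (pi\<^sup>2 / 3)))"
    using 2 tendsto_unique[OF trivial_limit_at_right_real] by blast
  also have "2 * sqrt 3 / pi * (- (pi\<^sup>2 / 3)) = - (2 * sqrt 3 * pi / 3)"
    by (simp add: power2_eq_square)
  finally show ?thesis unfolding D_def .
qed

section \<open>Return to the stated summands\<close>

lemma ram_prod_0: "ram_prod k 0 = (pochhammer (1/2) k)\<^sup>2 / ((fact k)\<^sup>2 * 9 ^ k)"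
proof (induction k)
  case (Suc k)
  then show ?case
    unfolding ram_prod_Suc Suc pochhammer_Suc fact_Suc of_nat_mult
    by (simp add: power_mult_distrib add.commute mult_ac)
qed (simp add: ram_prod_def)

text \<open>Duplication in numerator and denominator:
  \<open>(1/2)_{2k} = 4^k (1/4)_k (3/4)_k\<close> and \<open>(2k)! = 4^k (1/2)_k k!\<close>.\<close>

lemma ram_coeff_eq:
  "ram_coeff k = pochhammer (1/4) k * pochhammer (3/4) k / (pochhammer (1/2) k * fact k)"
  using pochhammer_double[of "1/4 :: complex" k]
  by (simp add: ram_coeff_def fact_double)

text \<open>One factor \<open>(1/2)_k\<close> of the square in \<open>ram_prod k 0\<close> cancels
  the one in the denominator of \<open>ram_coeff k\<close>. The inner sum matches after shifting its
  index by 1 and extracting -36.\<close>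

lemma ram_term_derivative_0:
  "deriv (ram_term k) 0 = -36 * complex_of_real ((8 * real k + 1) *
      (pochhammer (1/2) k * pochhammer (1/4) k * pochhammer (3/4) k)
        / ((fact k) ^ 3 * 9 ^ k) *
      (\<Sum>i=1..k. 1 / (2 * real i - 1)^2 - 1 / (36 * (real i)^2)))"
proof -
  have nz: "pochhammer (1/2 :: complex) k \<noteq> 0"
    unfolding pochhammer_eq_0_iff by (auto simp: complex_eq_iff)
  have "deriv (ram_term k) 0 = (8 * of_nat k + 1) * ram_coeff k *
      (ram_prod k 0 * (\<Sum>i<k. 1 / (of_nat i + 1)\<^sup>2 - 36 / (2 * of_nat i + 1)\<^sup>2))"
    unfolding ram_term_def[abs_def]
    by (intro DERIV_imp_deriv DERIV_cmult ram_prod_has_derivative_0)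
  also have "(\<Sum>i<k. 1 / (of_nat i + 1)\<^sup>2 - 36 / (2 * of_nat i + 1)\<^sup>2) =
      -36 * complex_of_real (\<Sum>i=1..k. 1 / (2 * real i - 1)^2 - 1 / (36 * (real i)^2))"
    (is "_ = -36 * complex_of_real ?H")
    unfolding One_nat_def sum.atLeast1_atMost_eq of_real_sum sum_distrib_left
    by (intro sum.cong refl) (simp add: algebra_simps)
  also have "(8 * of_nat k + 1) * ram_coeff k * (ram_prod k 0 * (-36 * complex_of_real ?H)) =
      -36 * ((8 * of_nat k + 1) * (ram_coeff k * ram_prod k 0) * complex_of_real ?H)"
    by (simp only: mult_ac)
  also have "ram_coeff k * ram_prod k 0 = complex_of_real
      (pochhammer (1/2) k * pochhammer (1/4) k * pochhammer (3/4) k / ((fact k) ^ 3 * 9 ^ k))"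
  proof -
    have "ram_coeff k * ram_prod k 0 =
      pochhammer (1/2) k * pochhammer (1/4) k * pochhammer (3/4) k / ((fact k) ^ 3 * 9 ^ k)"
      unfolding ram_coeff_eq ram_prod_0 using nz by (simp add: power2_eq_square power3_eq_cube mult_ac)
    then show ?thesis by (simp flip: pochhammer_of_real)
  qed
  also have "8 * of_nat k + 1 = complex_of_real (8 * real k + 1)" by simp
  finally show ?thesis by (simp only: of_real_mult[symmetric] times_divide_eq_right)
qed

theorem theorem1p2:
  shows "(\<lambda>n. let k = n + 1 in
            (8 * real k + 1) *
            (pochhammer (1/2::real) k * pochhammer (1/4) k * pochhammer (3/4) k)
              / ((fact k) ^ 3 * 9 ^ k) *
            (\<Sum>i=1..k. 1 / (2 * real i - 1)^2 - 1 / (36 * (real i)^2)))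
         sums (sqrt 3 * pi / 54)"
proof -
  define t where "t k = (8 * real k + 1) *
      (pochhammer (1/2::real) k * pochhammer (1/4) k * pochhammer (3/4) k)
        / ((fact k) ^ 3 * 9 ^ k) *
      (\<Sum>i=1..k. 1 / (2 * real i - 1)^2 - 1 / (36 * (real i)^2))" for k
  have "(\<lambda>k. deriv (ram_term k) 0) sums of_real (- (2 * sqrt 3 * pi / 3))"
    using deriv_ram_term_sums[of 0] by (simp add: deriv_ram_series_0)
  then have "(\<lambda>k. complex_of_real (-36 * t k)) sums of_real (- (2 * sqrt 3 * pi / 3))"
    unfolding ram_term_derivative_0 t_def[symmetric] by simp
  then have "(\<lambda>k. -36 * t k) sums (- (2 * sqrt 3 * pi / 3))"
    by (simp only: sums_of_real_iff)
  from sums_mult[OF this, of "-1/36"] have "t sums (sqrt 3 * pi / 54)" by (simp add: mult_ac)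
  \<comment> \<open>The inner sum is empty at \<open>k = 0\<close>, so the series may start at
    \<open>k = 1\<close>.\<close>
  moreover have "t 0 = 0" by (simp add: t_def)
  ultimately have "(\<lambda>n. t (Suc n)) sums (sqrt 3 * pi / 54)" by (simp add: sums_Suc_iff)
  then show ?thesis by (simp only: t_def Let_def Suc_eq_plus1)
qed

end
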